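(* Let $f:X\to Y$ be a smooth map of Frölicher spaces. Then $(\mathbf I_f,X)$ is an SNDR pair, where $X$ is identified with the subspace $\{[0,x]:x\in X\}$ of the flattened mapping cylinder $\mathbf I_f$ via $x\mapsto[0,x]$.
   Context: A Frölicher space is a triple $(X,\mathcal C_X,\mathcal F_X)$ with $\mathcal C_X\subseteq X^{\mathbb R}$, $\mathcal F_X\subseteq\mathbb R^X$, such that $\mathcal F_X=\{f\mid f\circ c\in C^\infty(\mathbb R,\mathbb R)\ \forall c\in\mathcal C_X\}$ and $\mathcal C_X=\{c\mid f\circ c\in C^\infty(\mathbb R,\mathbb R)\ \forall f\in\mathcal F_X\}$. A map $\varphi:X\to Y$ is smooth if $g\circ\varphi\in\mathcal F_X$ for all $g\in\mathcal F_Y$. Subspaces carry the initial structure; products the structure generated by $f\circ\pi_i$; coproducts, quotients and pushouts carry the final structure. $I$ is $[0,1]$ with the subspace structure from $\mathbb R$ ($\mathcal F_I$ its structure functions). $\mathbf I$ is $[0,1]$ with the structure generated by those $f\in\mathcal F_I$ for which some $0<\epsilon<1/4$ has $f$ constant on $[0,\epsilon)$ and on $(1-\epsilon,1]$. The flattened mapping cylinder $\mathbf I_f$ is the pushout of $f:X\to Y$ and $i_1:X\to\mathbf I\times X$, $i_1(x)=(1,x)$, i.e. the quotient of $(\mathbf I\times X)\sqcup Y$ by $(1,x)\sim f(x)$; its elements are written $[t,x]$ and $[y]$. FCIP: Let $i:A\to X$ be smooth. For a structure curve $x:\mathbb R\to X$ let $\Lambda(x,i)$ be the set of $s_*\in x^{-1}(i(A))$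 that are limits of sequences $s_n\in x^{-1}(X\setminus i(A))$. A structure function $g$ on $\mathbf I\times X$ has the FCIP w.r.t. $i$ if $g\circ c$ is $C^\infty$ for every map $c=(t,x):\mathbb R\to[0,1]\times X$ with $x$ a structure curve of $X$ and, for every $\epsilon>0$, $t$ $C^\infty$ on every open interval disjoint from $\bigcup_{s_*\in\Lambda(x,i)}[s_*-\epsilon,s_*+\epsilon]$. A map $g:\mathbf I\times X\to Z$ has the FCIP if $h\circ g$ does for every $h\in\mathcal F_Z$. SNDR pair: for a smooth inclusion $i:A\hookrightarrow X$, $(X,A)$ is an SNDR pair if there are a smooth $u:X\to\mathbf I$ with $u^{-1}(0)=i(A)$ and a smooth $H:\mathbf I\times X\to X$ having the FCIP w.r.t. $i$, with $H(0,x)=x$ for all $x$, $H(t,a)=a$ for all $t$ and $a\in i(A)$, and $H(1,x)\in i(A)$ whenever $u(x)<1$. *)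

theory Defs
  imports "HOL-Analysis.Analysis"
begin

text \<open>g is C-infinity on the open set J: every iterated derivative is differentiable at
  every point of J (for open J this only depends on g restricted to J).\<close>
definition C_inf_on :: "real set \<Rightarrow> (real \<Rightarrow> real) \<Rightarrow> bool" where
  "C_inf_on J g \<longleftrightarrow> (\<forall>n::nat. \<forall>s\<in>J. ((deriv ^^ n) g) differentiable (at s))"

definition C_inf :: "(real \<Rightarrow> real) \<Rightarrow> bool" where
  "C_inf g \<longleftrightarrow> C_inf_on UNIV g"

record 'a frol =
  fcarrier :: "'a set"
  fcurves :: "(real \<Rightarrow> 'a) set"
  ffuns :: "('a \<Rightarrow> real) set"

definition gen_curves :: "'a set \<Rightarrow> ('a \<Rightarrow> real) set \<Rightarrow> (real \<Rightarrow> 'a) set" where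
  "gen_curves S F = {c. (\<forall>t. c t \<in> S) \<and> (\<forall>f\<in>F. C_inf (f \<circ> c))}"

definition gen_funs :: "(real \<Rightarrow> 'a) set \<Rightarrow> ('a \<Rightarrow> real) set" where
  "gen_funs C = {f. \<forall>c\<in>C. C_inf (f \<circ> c)}"

definition frolicher :: "'a frol \<Rightarrow> bool" where
  "frolicher X \<longleftrightarrow> ffuns X = gen_funs (fcurves X)
                 \<and> fcurves X = gen_curves (fcarrier X) (ffuns X)"

definition gen_space :: "'a set \<Rightarrow> ('a \<Rightarrow> real) set \<Rightarrow> 'a frol" where
  "gen_space S F0 = \<lparr>fcarrier = S, fcurves = gen_curves S F0,
                      ffuns = gen_funs (gen_curves S F0)\<rparr>"

definition smooth_map :: "'a frol \<Rightarrow> 'b frol \<Rightarrow> ('a \<Rightarrow> 'b) \<Rightarrow> bool" where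
  "smooth_map X Y \<phi> \<longleftrightarrow> \<phi> ` fcarrier X \<subseteq> fcarrier Y \<and> (\<forall>g\<in>ffuns Y. g \<circ> \<phi> \<in> ffuns X)"

text \<open>Subspace: initial structure on A w.r.t. the inclusion.\<close>
definition subspace :: "'a frol \<Rightarrow> 'a set \<Rightarrow> 'a frol" where
  "subspace X A = gen_space A (ffuns X)"

definition prod_space :: "'a frol \<Rightarrow> 'b frol \<Rightarrow> ('a \<times> 'b) frol" where
  "prod_space X Y = gen_space (fcarrier X \<times> fcarrier Y)
      ({f \<circ> fst | f. f \<in> ffuns X} \<union> {g \<circ> snd | g. g \<in> ffuns Y})"

text \<open>Coproduct: final structure w.r.t. Inl and Inr.\<close>
definition sum_space :: "'a frol \<Rightarrow> 'b frol \<Rightarrow> ('a + 'b) frol" where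
  "sum_space X Y = gen_space (Inl ` fcarrier X \<union> Inr ` fcarrier Y)
      {g. g \<circ> Inl \<in> ffuns X \<and> g \<circ> Inr \<in> ffuns Y}"

text \<open>Quotient by an equivalence relation r on the carrier: final structure w.r.t. the
  projection x \<mapsto> r``{x}.\<close>
definition quot_space :: "'a frol \<Rightarrow> ('a \<times> 'a) set \<Rightarrow> 'a set frol" where
  "quot_space X r = gen_space (fcarrier X // r) {g. (\<lambda>x. g (r `` {x})) \<in> ffuns X}"

definition real_space :: "real frol" where
  "real_space = \<lparr>fcarrier = UNIV, fcurves = {c. C_inf c}, ffuns = {f. C_inf f}\<rparr>"

definition I_space :: "real frol" where
  "I_space = subspace real_space {0..1}"

definition flat_I :: "real frol" where
  "flat_I = gen_space {0..1}
     {f \<in> ffuns I_space. \<exists>\<epsilon>. 0 < \<epsilon> \<and> \<epsilon> < 1/4 \<and>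
         (\<forall>s\<in>{0..<\<epsilon>}. \<forall>t\<in>{0..<\<epsilon>}. f s = f t) \<and>
         (\<forall>s\<in>{1-\<epsilon><..1}. \<forall>t\<in>{1-\<epsilon><..1}. f s = f t)}"

definition cyl_rel :: "'a frol \<Rightarrow> 'b frol \<Rightarrow> ('a \<Rightarrow> 'b) \<Rightarrow>
     (((real \<times> 'a) + 'b) \<times> ((real \<times> 'a) + 'b)) set" where
  "cyl_rel X Y f =
     (let D = fcarrier (sum_space (prod_space flat_I X) Y);
          R0 = {(Inl (1, x), Inr (f x)) | x. x \<in> fcarrier X}
      in (R0 \<union> R0\<inverse>)\<^sup>* \<inter> (D \<times> D))"

definition mapping_cyl :: "'a frol \<Rightarrow> 'b frol \<Rightarrow> ('a \<Rightarrow> 'b) \<Rightarrow> ((real \<times> 'a) + 'b) set frol" where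
  "mapping_cyl X Y f = quot_space (sum_space (prod_space flat_I X) Y) (cyl_rel X Y f)"

definition cyl_pt :: "'a frol \<Rightarrow> 'b frol \<Rightarrow> ('a \<Rightarrow> 'b) \<Rightarrow> real \<Rightarrow> 'a \<Rightarrow> ((real \<times> 'a) + 'b) set" where
  "cyl_pt X Y f t x = cyl_rel X Y f `` {Inl (t, x)}"

definition Lambda_set :: "'x frol \<Rightarrow> 'a frol \<Rightarrow> ('a \<Rightarrow> 'x) \<Rightarrow> (real \<Rightarrow> 'x) \<Rightarrow> real set" where
  "Lambda_set X A i x = {s. x s \<in> i ` fcarrier A \<and>
      (\<exists>sq::nat \<Rightarrow> real. (\<forall>n. x (sq n) \<in> fcarrier X - i ` fcarrier A) \<and> sq \<longlonglongrightarrow> s)}"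

definition fcip_fun :: "'x frol \<Rightarrow> 'a frol \<Rightarrow> ('a \<Rightarrow> 'x) \<Rightarrow> (real \<times> 'x \<Rightarrow> real) \<Rightarrow> bool" where
  "fcip_fun X A i g \<longleftrightarrow> g \<in> ffuns (prod_space flat_I X) \<and>
     (\<forall>t x. (\<forall>s. t s \<in> {0..1}) \<and> x \<in> fcurves X \<and>
        (\<forall>\<epsilon>>0. \<forall>J. open J \<and> is_interval J \<and>
             J \<inter> (\<Union>s\<in>Lambda_set X A i x. {s - \<epsilon>..s + \<epsilon>}) = {} \<longrightarrow> C_inf_on J t)
        \<longrightarrow> C_inf (g \<circ> (\<lambda>s. (t s, x s))))"

definition fcip_map :: "'x frol \<Rightarrow> 'a frol \<Rightarrow> ('a \<Rightarrow> 'x) \<Rightarrow> 'z frol \<Rightarrow> (real \<times> 'x \<Rightarrow> 'z) \<Rightarrow> bool" where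
  "fcip_map X A i Z G \<longleftrightarrow> (\<forall>h\<in>ffuns Z. fcip_fun X A i (h \<circ> G))"

definition SNDR_pair :: "'x frol \<Rightarrow> 'a frol \<Rightarrow> ('a \<Rightarrow> 'x) \<Rightarrow> bool" where
  "SNDR_pair X A i \<longleftrightarrow> smooth_map A X i \<and> inj_on i (fcarrier A) \<and>
     (\<exists>u H. smooth_map X flat_I u \<and> {x \<in> fcarrier X. u x = 0} = i ` fcarrier A \<and>
        smooth_map (prod_space flat_I X) X H \<and> fcip_map X A i X H \<and>
        (\<forall>x\<in>fcarrier X. H (0, x) = x) \<and>
        (\<forall>t\<in>{0..1}. \<forall>a\<in>i ` fcarrier A. H (t, a) = a) \<and>
        (\<forall>x\<in>fcarrier X. u x < 1 \<longrightarrow> H (1, x) \<in> i ` fcarrier A))"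

end

theory Submission
  imports Defs
begin

text \<open>The deformation is \<open>H(s, [t, x]) = [(1 - \<sigma>(s) \<lambda>(t)) t, x]\<close> and \<open>H(s, [y]) = [y]\<close>, with
  \<open>u = min 1 (2 t)\<close>; here \<open>\<sigma>\<close> is a smooth step that is constant near \<open>0\<close> and near \<open>1\<close>, while
  \<open>\<lambda> = 1\<close> on \<open>[0, 1/2]\<close> and \<open>\<lambda> = 0\<close> on \<open>[3/4, 1]\<close>.  Structure curves of the flattened interval
  are the continuous curves that are smooth wherever their value lies in the open interval.  Hence
  along a structure curve of the cylinder the new first coordinate only has to be continuous where
  \<open>t = 0\<close>, which holds for any time parameter because it lies between \<open>0\<close> and \<open>t\<close>; and a time
  parameter admissible in the FCIP is smooth wherever \<open>t > 0\<close>.  Structure curves of the cylinder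
  lift to \<open>(t, x)\<close> locally where \<open>t < 1\<close>, and where \<open>t > 3/4\<close> the deformation is the identity, so
  the gluing with the target space never has to be analysed.\<close>

section \<open>Smooth real functions on open sets\<close>

text \<open>Choosing some derivative \<open>g'\<close> at each order, constrained only on
  \<open>J\<close>, instead of iterating \<open>deriv\<close>, lets the sum, product and chain rules
  be proved by induction on the order.\<close>

primrec C_k_on :: "nat \<Rightarrow> real set \<Rightarrow> (real \<Rightarrow> real) \<Rightarrow> bool" where
  "C_k_on 0 J g \<longleftrightarrow> True"
| "C_k_on (Suc n) J g \<longleftrightarrow>
     (\<exists>g'. (\<forall>s\<in>J. (g has_real_derivative g' s) (at s)) \<and> C_k_on n J g')"

lemma C_k_on_cong:
  assumes "open J" "\<And>s. s \<in> J \<Longrightarrow> g s = h s" "C_k_on n J g"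
  shows "C_k_on n J h"
proof (cases n)
  case (Suc m)
  then obtain g' where g': "\<forall>s\<in>J. (g has_real_derivative g' s) (at s)" "C_k_on m J g'"
    using assms(3) by auto
  have "(h has_real_derivative g' s) (at s)" if "s \<in> J" for s
    using has_field_derivative_transform_within_open[of g "g' s" s J h] g'(1) that assms(1,2)
    by blast
  then show ?thesis using g' Suc by auto
qed auto

text \<open>Forwards, \<open>deriv g\<close> is the witness at each order. Backwards, a witness
  \<open>g'\<close> equals \<open>deriv g\<close> on the open set \<open>J\<close>, so it can be
  replaced by \<open>deriv g\<close>.\<close>

lemma C_inf_on_iff_C_k_on:
  assumes "open J"
  shows "C_inf_on J g \<longleftrightarrow> (\<forall>n. C_k_on n J g)"
proof (intro iffI allI)
  fix n assume "C_inf_on J g"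
  then show "C_k_on n J g"
  proof (induction n arbitrary: g)
    case (Suc n)
    have "(g has_real_derivative deriv g s) (at s)" if "s \<in> J" for s
      using Suc.prems that unfolding C_inf_on_def
      by (auto simp: DERIV_deriv_iff_real_differentiable dest!: spec[of _ 0])
    moreover have "C_inf_on J (deriv g)"
      unfolding C_inf_on_def
    proof (intro allI ballI)
      fix m s assume "s \<in> J"
      with Suc.prems have "(deriv ^^ Suc m) g differentiable at s"
        unfolding C_inf_on_def by blast
      then show "(deriv ^^ m) (deriv g) differentiable at s"
        by (simp add: funpow_swap1)
    qed
    ultimately show ?case using Suc.IH by auto
  qed auto
next
  assume *: "\<forall>n. C_k_on n J g"
  have "((deriv ^^ n) g) differentiable (at s)" if "C_k_on (Suc n) J g" "s \<in> J" for n s g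
    using that(1)
  proof (induction n arbitrary: g)
    case 0
    then show ?case using that(2) by (auto simp: real_differentiable_def)
  next
    case (Suc n)
    from Suc.prems obtain g' where g': "\<forall>s\<in>J. (g has_real_derivative g' s) (at s)"
      "C_k_on (Suc n) J g'" by auto
    have "C_k_on (Suc n) J (deriv g)"
      by (rule C_k_on_cong[OF assms _ g'(2)]) (use DERIV_imp_deriv g'(1) in fastforce)
    then show ?case using Suc.IH by (simp add: funpow_swap1 del: C_k_on.simps)
  qed
  with * show "C_inf_on J g" unfolding C_inf_on_def by blast
qed

lemma C_k_on_Suc_imp: "C_k_on (Suc n) J g \<Longrightarrow> C_k_on n J g"
proof (induction n arbitrary: g)
  case (Suc n)
  then obtain g' where "\<forall>s\<in>J. (g has_real_derivative g' s) (at s)" "C_k_on (Suc n) J g'"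
    by (auto simp del: C_k_on.simps(2) simp: C_k_on.simps(2)[of "Suc n"])
  then show ?case using Suc.IH by (auto simp del: C_k_on.simps(2) simp: C_k_on.simps(2)[of n])
qed simp

lemma C_k_on_const: "C_k_on n J (\<lambda>s. k)"
  by (induction n arbitrary: k) (auto intro!: exI[of _ "\<lambda>_. 0"])

lemma C_k_on_ident: "C_k_on n J (\<lambda>s. s)"
  by (cases n) (auto intro!: exI[of _ "\<lambda>_. 1"] C_k_on_const)

lemma C_k_on_add: "C_k_on n J g \<Longrightarrow> C_k_on n J h \<Longrightarrow> C_k_on n J (\<lambda>s. g s + h s)"
proof (induction n arbitrary: g h)
  case (Suc n)
  then obtain g' h' where "\<forall>s\<in>J. (g has_real_derivative g' s) (at s)" "C_k_on n J g'"
    "\<forall>s\<in>J. (h has_real_derivative h' s) (at s)" "C_k_on n J h'" by auto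
  then show ?case
    using Suc.IH by (auto intro!: exI[of _ "\<lambda>s. g' s + h' s"] DERIV_add)
qed auto

lemma C_k_on_mult: "C_k_on n J g \<Longrightarrow> C_k_on n J h \<Longrightarrow> C_k_on n J (\<lambda>s. g s * h s)"
proof (induction n arbitrary: g h)
  case (Suc n)
  then obtain g' h' where *: "\<forall>s\<in>J. (g has_real_derivative g' s) (at s)" "C_k_on n J g'"
    "\<forall>s\<in>J. (h has_real_derivative h' s) (at s)" "C_k_on n J h'" by auto
  \<comment> \<open>The product rule mixes the derivatives, known to order \<open>n\<close>, with
    \<open>g\<close> and \<open>h\<close> themselves, whose order \<open>Suc n\<close> is lowered to
    match.\<close>
  have "C_k_on n J (\<lambda>s. g' s * h s + h' s * g s)"
    by (intro C_k_on_add Suc.IH * Suc.prems[THEN C_k_on_Suc_imp])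
  then show ?case
    using * by (auto intro!: exI[of _ "\<lambda>s. g' s * h s + h' s * g s"] DERIV_mult)
qed auto

lemma C_k_on_compose:
  "C_k_on n K g \<Longrightarrow> C_k_on n J h \<Longrightarrow> h ` J \<subseteq> K \<Longrightarrow> C_k_on n J (\<lambda>s. g (h s))"
proof (induction n arbitrary: g h)
  case (Suc n)
  then obtain g' h' where *: "\<forall>s\<in>K. (g has_real_derivative g' s) (at s)" "C_k_on n K g'"
    "\<forall>s\<in>J. (h has_real_derivative h' s) (at s)" "C_k_on n J h'" by auto
  have "C_k_on n J (\<lambda>s. g' (h s) * h' s)"
    by (rule C_k_on_mult[OF Suc.IH[OF *(2) C_k_on_Suc_imp[OF Suc.prems(2)] Suc.prems(3)] *(4)])
  moreover have "((\<lambda>s. g (h s)) has_real_derivative g' (h s) * h' s) (at s)" if "s \<in> J" for s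
    using DERIV_chain2[of g "g' (h s)" h s "h' s" UNIV] * that Suc.prems(3) by blast
  ultimately show ?case by (auto intro!: exI[of _ "\<lambda>s. g' (h s) * h' s"])
qed auto

lemma C_k_on_inverse:
  "C_k_on n J g \<Longrightarrow> (\<And>s. s \<in> J \<Longrightarrow> g s \<noteq> 0) \<Longrightarrow> C_k_on n J (\<lambda>s. inverse (g s))"
proof (induction n arbitrary: g)
  case (Suc n)
  then obtain g' where *: "\<forall>s\<in>J. (g has_real_derivative g' s) (at s)" "C_k_on n J g'" by auto
  have "C_k_on n J (\<lambda>s. - 1 * (inverse (g s) * g' s * inverse (g s)))"
    by (intro C_k_on_mult C_k_on_const Suc.IH * C_k_on_Suc_imp[OF Suc.prems(1)] Suc.prems(2))
  then show ?case
    using * Suc.prems(2) DERIV_inverse'[of g _ _ UNIV]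
    by (auto intro!: exI[of _ "\<lambda>s. - (inverse (g s) * g' s * inverse (g s))"])
qed auto

lemma C_inf_on_cong:
  assumes "open J" "\<And>s. s \<in> J \<Longrightarrow> g s = h s"
  shows "C_inf_on J g \<longleftrightarrow> C_inf_on J h"
  using C_k_on_cong[OF assms] C_k_on_cong[OF assms(1) assms(2)[symmetric]] assms(1)
  by (auto simp: C_inf_on_iff_C_k_on)

lemma C_inf_on_subset: "C_inf_on K g \<Longrightarrow> J \<subseteq> K \<Longrightarrow> C_inf_on J g"
  unfolding C_inf_on_def by blast

lemma C_inf_imp_C_inf_on: "C_inf g \<Longrightarrow> C_inf_on J g"
  unfolding C_inf_def by (auto intro: C_inf_on_subset)

lemma C_inf_on_local:
  assumes "\<And>s. s \<in> J \<Longrightarrow> \<exists>K. open K \<and> s \<in> K \<and> C_inf_on K g"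
  shows "C_inf_on J g"
  using assms unfolding C_inf_on_def by blast

lemma C_inf_on_continuous: "C_inf_on J g \<Longrightarrow> s \<in> J \<Longrightarrow> isCont g s"
  unfolding C_inf_on_def
  by (auto dest!: spec[of _ 0] intro: differentiable_imp_continuous_within)

lemma C_inf_on_const: "C_inf_on J (\<lambda>s. k)"
  using C_inf_on_iff_C_k_on[OF open_UNIV] C_k_on_const C_inf_on_subset by blast

lemma C_inf_on_ident: "C_inf_on J (\<lambda>s. s)"
  using C_inf_on_iff_C_k_on[OF open_UNIV] C_k_on_ident C_inf_on_subset by blast

lemma C_inf_on_add:
  "open J \<Longrightarrow> C_inf_on J g \<Longrightarrow> C_inf_on J h \<Longrightarrow> C_inf_on J (\<lambda>s. g s + h s)"
  by (simp add: C_inf_on_iff_C_k_on C_k_on_add)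

lemma C_inf_on_mult:
  "open J \<Longrightarrow> C_inf_on J g \<Longrightarrow> C_inf_on J h \<Longrightarrow> C_inf_on J (\<lambda>s. g s * h s)"
  by (simp add: C_inf_on_iff_C_k_on C_k_on_mult)

lemma C_inf_on_diff:
  assumes "open J" "C_inf_on J g" "C_inf_on J h"
  shows "C_inf_on J (\<lambda>s. g s - h s)"
  using C_inf_on_add[OF assms(1,2) C_inf_on_mult[OF assms(1) C_inf_on_const[of J "-1"] assms(3)]]
  by simp

lemma C_inf_on_divide:
  assumes "open J" "C_inf_on J g" "C_inf_on J h" "\<And>s. s \<in> J \<Longrightarrow> h s \<noteq> 0"
  shows "C_inf_on J (\<lambda>s. g s / h s)"
  using assms by (simp add: C_inf_on_iff_C_k_on divide_inverse C_k_on_mult C_k_on_inverse)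

lemma C_inf_on_compose:
  assumes "C_inf g" "open J" "C_inf_on J h"
  shows "C_inf_on J (\<lambda>s. g (h s))"
  using assms C_inf_on_iff_C_k_on[OF open_UNIV, of g] C_k_on_compose[of _ UNIV g J h]
  by (simp add: C_inf_def C_inf_on_iff_C_k_on)

section \<open>A smooth step function\<close>

text \<open>For \<open>k = 0\<close> this is the classical flat function exp(-1/x). The powers of
  1/x are included because differentiation then stays within linear combinations of the
  family.\<close>

definition flat_exp :: "nat \<Rightarrow> real \<Rightarrow> real" where
  "flat_exp k x = (if x > 0 then inverse x ^ k * exp (- inverse x) else 0)"

lemma flat_exp_tendsto_0: "(flat_exp k \<longlongrightarrow> 0) (at 0)"
proof -
  have "((\<lambda>x. inverse x ^ k / exp (inverse x)) \<longlongrightarrow> 0) (at_right (0::real))"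
    using filterlim_compose[OF tendsto_power_div_exp_0 filterlim_inverse_at_top_right] .
  then have "(flat_exp k \<longlongrightarrow> 0) (at_right 0)"
    by (rule Lim_transform_eventually)
       (auto simp: flat_exp_def exp_minus field_simps eventually_at_filter)
  moreover have "(flat_exp k \<longlongrightarrow> 0) (at_left 0)"
    by (rule Lim_transform_eventually[OF tendsto_const])
       (auto simp: flat_exp_def eventually_at_filter)
  ultimately show ?thesis by (simp add: filterlim_split_at)
qed

lemma flat_exp_has_derivative:
  "(flat_exp k has_real_derivative (- real k) * flat_exp (k + 1) x + flat_exp (k + 2) x) (at x)"
proof (cases x "0::real" rule: linorder_cases)
  case less
  then have "((\<lambda>_. 0) has_real_derivative
      (- real k) * flat_exp (k + 1) x + flat_exp (k + 2) x) (at x)"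
    by (simp add: flat_exp_def)
  then show ?thesis
    by (rule has_field_derivative_transform_within_open[where S = "{..<0}"])
       (use less in \<open>auto simp: flat_exp_def\<close>)
next
  case equal
  \<comment> \<open>For h different from 0 the difference quotient at 0 is exactly
    \<open>flat_exp (k + 1) h\<close>, whose limit is already known.\<close>
  have "((\<lambda>h. (flat_exp k (0 + h) - flat_exp k 0) / h) \<longlongrightarrow> 0) (at 0)"
    by (rule Lim_transform_eventually[OF flat_exp_tendsto_0[of "k + 1"]])
       (auto simp: flat_exp_def eventually_at_filter field_simps)
  then show ?thesis
    unfolding equal by (simp add: DERIV_def flat_exp_def)
next
  case greater
  have "((\<lambda>x. inverse x ^ k * exp (- inverse x)) has_real_derivative
      (- real k) * flat_exp (k + 1) x + flat_exp (k + 2) x) (at x)"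
    using greater
    by (auto intro!: derivative_eq_intros simp: flat_exp_def)
       (cases k; simp add: field_simps)
  then show ?thesis
    by (rule has_field_derivative_transform_within_open[where S = "{0<..}"])
       (use greater in \<open>auto simp: flat_exp_def\<close>)
qed

lemma C_inf_flat_exp: "C_inf (flat_exp k)"
proof -
  have "C_k_on n UNIV (flat_exp k)" for n
  proof (induction n arbitrary: k)
    case (Suc n)
    have "C_k_on n UNIV (\<lambda>x. (- real k) * flat_exp (k + 1) x + flat_exp (k + 2) x)"
      by (intro C_k_on_add C_k_on_mult C_k_on_const Suc.IH)
    then show ?case
      using flat_exp_has_derivative[of k] unfolding C_k_on.simps
      by (intro exI[of _ "\<lambda>x. (- real k) * flat_exp (k + 1) x + flat_exp (k + 2) x"]) blast
  qed auto
  then show ?thesis by (simp add: C_inf_def C_inf_on_iff_C_k_on)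
qed

definition smooth_step :: "real \<Rightarrow> real \<Rightarrow> real \<Rightarrow> real" where
  "smooth_step a b x = flat_exp 0 (x - a) / (flat_exp 0 (x - a) + flat_exp 0 (b - x))"

text \<open>No x satisfies both x \<le> a and b \<le> x, so at least one of the two nonnegative
  summands is positive.\<close>

lemma smooth_step_denominator_pos:
  "a < b \<Longrightarrow> flat_exp 0 (x - a) + flat_exp 0 (b - x) > 0"
  by (cases "x > a"; cases "x < b") (auto simp: flat_exp_def add_pos_pos)

lemma C_inf_smooth_step:
  assumes "a < b"
  shows "C_inf (smooth_step a b)"
  unfolding C_inf_def smooth_step_def
proof (intro C_inf_on_divide C_inf_on_add open_UNIV)
  \<comment> \<open>The first claim is listed twice because it arises both as the numerator and as a
    summand of the denominator.\<close>
  show "C_inf_on UNIV (\<lambda>x. flat_exp 0 (x - a))" "C_inf_on UNIV (\<lambda>x. flat_exp 0 (x - a))" "C_inf_on UNIV (\<lambda>x. flat_exp 0 (b - x))"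
    by (intro C_inf_on_compose[OF C_inf_flat_exp] C_inf_on_diff C_inf_on_const C_inf_on_ident
        open_UNIV)+
qed (use smooth_step_denominator_pos[OF assms] in \<open>simp add: less_imp_neq[THEN not_sym]\<close>)

lemma smooth_step_eq_0: "x \<le> a \<Longrightarrow> smooth_step a b x = 0"
  by (simp add: smooth_step_def flat_exp_def)

lemma smooth_step_eq_1: "a < b \<Longrightarrow> b \<le> x \<Longrightarrow> smooth_step a b x = 1"
  by (simp add: smooth_step_def flat_exp_def)

lemma smooth_step_bounds: "a < b \<Longrightarrow> 0 \<le> smooth_step a b x \<and> smooth_step a b x \<le> 1"
  using smooth_step_denominator_pos[of a b x]
  by (auto simp: smooth_step_def flat_exp_def divide_simps)

section \<open>Locality of generated structures\<close>

text \<open>Precomposition with \<theta> turns a curve that is controlled only near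
  \<open>s0\<close> into a curve on the whole line with the same germ at \<open>s0\<close>.\<close>

lemma C_inf_retraction_to_interval:
  fixes s0 r :: real
  assumes "0 < r"
  obtains \<theta> where "C_inf \<theta>" "\<And>s. \<bar>\<theta> s - s0\<bar> < r" "\<And>s. \<bar>s - s0\<bar> < r / 4 \<Longrightarrow> \<theta> s = s"
proof
  \<comment> \<open>A bump that is 1 within distance r/4 of \<open>s0\<close> and 0 beyond r/2. The
    step is applied to the squared distance because the distance itself is not smooth at
    \<open>s0\<close>.\<close>
  define \<beta> where "\<beta> s = 1 - smooth_step ((r/4)^2) ((r/2)^2) ((s - s0) * (s - s0))" for s
  define \<theta> where "\<theta> s = s0 + (s - s0) * \<beta> s" for s
  have lt: "(r/4)^2 < (r/2)^2" using assms by (simp add: power2_eq_square)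
  have "C_inf_on UNIV \<beta>"
    unfolding \<beta>_def
    by (intro C_inf_on_diff C_inf_on_mult C_inf_on_compose[OF C_inf_smooth_step[OF lt]]
        C_inf_on_const C_inf_on_ident open_UNIV)
  then show "C_inf \<theta>"
    unfolding C_inf_def \<theta>_def
    by (intro C_inf_on_diff C_inf_on_add C_inf_on_mult C_inf_on_const C_inf_on_ident open_UNIV)
  show "\<bar>\<theta> s - s0\<bar> < r" for s
  proof (cases "\<bar>s - s0\<bar> < r/2")
    case True
    have "\<bar>s - s0\<bar> * \<bar>\<beta> s\<bar> \<le> \<bar>s - s0\<bar> * 1"
      using smooth_step_bounds[OF lt] by (intro mult_left_mono) (auto simp: \<beta>_def)
    then show ?thesis using True assms by (simp add: \<theta>_def abs_mult)
  next
    case False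
    then have "(r/2)^2 \<le> (s - s0)^2"
      using assms by (intro abs_le_square_iff[THEN iffD1]) auto
    then show ?thesis
      using assms smooth_step_eq_1[OF lt] by (simp add: \<theta>_def \<beta>_def power2_eq_square)
  qed
  show "\<theta> s = s" if "\<bar>s - s0\<bar> < r / 4" for s
  proof -
    have "(s - s0)^2 \<le> (r/4)^2"
      using assms that by (intro abs_le_square_iff[THEN iffD1]) auto
    then show ?thesis
      by (simp add: \<theta>_def \<beta>_def smooth_step_eq_0 power2_eq_square)
  qed
qed

text \<open>Structure functions are tested only on global curves. Near each point of
  \<open>J\<close>, \<open>c\<close> is replaced by \<open>c \<circ> \<theta>\<close>, a global
  structure curve that stays in the part of \<open>c\<close> over \<open>J\<close> and agrees with
  \<open>c\<close> close to the point.\<close>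

lemma gen_funs_local:
  assumes "g \<in> gen_funs (gen_curves S F)" "open J" "\<And>s. s \<in> J \<Longrightarrow> c s \<in> S"
    and "\<And>f. f \<in> F \<Longrightarrow> C_inf_on J (\<lambda>s. f (c s))"
  shows "C_inf_on J (\<lambda>s. g (c s))"
proof (rule C_inf_on_local)
  fix s0 assume "s0 \<in> J"
  then obtain r where r: "0 < r" "ball s0 r \<subseteq> J" using assms(2) openE by blast
  then obtain \<theta> where \<theta>: "C_inf \<theta>" "\<And>s. \<bar>\<theta> s - s0\<bar> < r" "\<And>s. \<bar>s - s0\<bar> < r / 4 \<Longrightarrow> \<theta> s = s"
    using C_inf_retraction_to_interval by metis
  have \<theta>J: "\<theta> s \<in> J" for s using r(2) \<theta>(2)[of s] by (auto simp: dist_real_def abs_minus_commute)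
  have "C_inf (\<lambda>s. f (c (\<theta> s)))" if "f \<in> F" for f
    using assms(4)[OF that] \<theta>(1) \<theta>J C_k_on_compose[of _ J "\<lambda>s. f (c s)" UNIV \<theta>] assms(2)
    by (simp add: C_inf_def C_inf_on_iff_C_k_on image_subset_iff)
  then have "c \<circ> \<theta> \<in> gen_curves S F" using \<theta>J assms(3) by (auto simp: gen_curves_def comp_def)
  then have "C_inf (\<lambda>s. g (c (\<theta> s)))" using assms(1) by (auto simp: gen_funs_def comp_def)
  then have "C_inf_on (ball s0 (r/4)) (\<lambda>s. g (c (\<theta> s)))" by (rule C_inf_imp_C_inf_on)
  then have "C_inf_on (ball s0 (r/4)) (\<lambda>s. g (c s))"
    by (subst (asm) C_inf_on_cong[where h = "\<lambda>s. g (c s)"])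
       (auto simp: \<theta>(3) dist_real_def abs_minus_commute)
  then show "\<exists>K. open K \<and> s0 \<in> K \<and> C_inf_on K (\<lambda>s. g (c s))"
    using r(1) by (intro exI[of _ "ball s0 (r/4)"]) auto
qed

lemma generator_in_gen_funs: "f \<in> F \<Longrightarrow> f \<in> gen_funs (gen_curves S F)"
  by (auto simp: gen_funs_def gen_curves_def)

section \<open>The flattened interval\<close>

text \<open>Test functions defined on the whole line that are generators of \<open>flat_I\<close>.
  They suffice to detect its curves, see \<open>flat_curve_onI\<close>.\<close>

definition flat_test :: "(real \<Rightarrow> real) \<Rightarrow> bool" where
  "flat_test b \<longleftrightarrow> C_inf b \<and> (\<exists>p>0. \<forall>t\<le>p. b t = b 0) \<and> (\<exists>q<1. \<forall>t\<ge>q. b t = b 1)"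

lemma flat_testI:
  assumes "C_inf b" "0 < p" "q < 1" "\<And>t. t \<le> p \<Longrightarrow> b t = b 0" "\<And>t. q \<le> t \<Longrightarrow> b t = b 1"
  shows "flat_test b"
  using assms unfolding flat_test_def by blast

lemma flat_test_in_flat_I:
  assumes "flat_test b"
  shows "b \<in> ffuns flat_I"
proof -
  from assms obtain p q where *: "C_inf b" "p > 0" "\<And>t. t \<le> p \<Longrightarrow> b t = b 0"
    "q < 1" "\<And>t. t \<ge> q \<Longrightarrow> b t = b 1"
    by (auto simp: flat_test_def)
  have "C_inf (b \<circ> c)" if "c \<in> gen_curves {0..1} {f. C_inf f}" for c
  proof -
    \<comment> \<open>The identity is itself a smooth function on the line, so a structure curve of
      the unit interval is smooth as a real function.\<close>
    have "C_inf ((\<lambda>s. s) \<circ> c)"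
      using that C_inf_on_ident[of UNIV] unfolding gen_curves_def C_inf_def by blast
    then show ?thesis
      using C_inf_on_compose[OF *(1) open_UNIV, of c] by (simp add: C_inf_def comp_def)
  qed
  then have "b \<in> ffuns I_space"
    by (auto simp: I_space_def subspace_def gen_space_def real_space_def gen_funs_def)
  moreover have "\<exists>\<epsilon>. 0 < \<epsilon> \<and> \<epsilon> < 1/4 \<and> (\<forall>s\<in>{0..<\<epsilon>}. \<forall>t\<in>{0..<\<epsilon>}. b s = b t) \<and>
         (\<forall>s\<in>{1-\<epsilon><..1}. \<forall>t\<in>{1-\<epsilon><..1}. b s = b t)"
  \<comment> \<open>The entry 1/8 enforces the bound 1/4; the other two keep the end zones inside
    the regions where \<open>b\<close> is constant.\<close>
  proof (intro exI[of _ "min (min p (1 - q)) (1/8)"] conjI ballI)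
    show "b s = b t" if "s \<in> {0..<min (min p (1 - q)) (1/8)}" "t \<in> {0..<min (min p (1 - q)) (1/8)}"
      for s t using that *(3)[of s] *(3)[of t] by simp
    show "b s = b t" if "s \<in> {1 - min (min p (1 - q)) (1/8)<..1}"
      "t \<in> {1 - min (min p (1 - q)) (1/8)<..1}" for s t
      using that *(5)[of s] *(5)[of t] by (auto simp: min_def split: if_splits)
  qed (use *(2,4) in \<open>auto simp: min_def\<close>)
  ultimately show ?thesis
    unfolding flat_I_def gen_space_def frol.simps
    by (intro generator_in_gen_funs CollectI conjI)
qed

lemma flat_test_smooth_step:
  assumes "0 < a" "a < b" "b < 1"
  shows "flat_test (smooth_step a b)"
  using assms
  by (intro flat_testI[of _ a b] C_inf_smooth_step) (auto simp: smooth_step_eq_0 smooth_step_eq_1)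

lemma flat_test_one_minus: "flat_test b \<Longrightarrow> flat_test (\<lambda>t. 1 - b t)"
  by (auto simp: flat_test_def C_inf_def intro: C_inf_on_diff C_inf_on_const)

text \<open>The description of the curves of \<open>flat_I\<close>, localised to \<open>J\<close>.
  At the values 0 and 1 only continuity is demanded.\<close>

definition flat_curve_on :: "real set \<Rightarrow> (real \<Rightarrow> real) \<Rightarrow> bool" where
  "flat_curve_on J c \<longleftrightarrow> (\<forall>s\<in>J. c s \<in> {0..1} \<and> isCont c s \<and>
     (0 < c s \<and> c s < 1 \<longrightarrow> (\<exists>K. open K \<and> s \<in> K \<and> C_inf_on K c)))"

text \<open>By locality only generators matter. At an interior value the curve is locally smooth; at
  an end value continuity keeps it in the zone where the generator is constant.\<close>

lemma flat_I_funs_local: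
  assumes "g \<in> ffuns flat_I" "open J" "flat_curve_on J c"
  shows "C_inf_on J (\<lambda>s. g (c s))"
proof (rule gen_funs_local[where g = g and c = c])
  show "g \<in> gen_funs (gen_curves {0..1} {f \<in> ffuns I_space. \<exists>\<epsilon>. 0 < \<epsilon> \<and> \<epsilon> < 1/4 \<and>
         (\<forall>s\<in>{0..<\<epsilon>}. \<forall>t\<in>{0..<\<epsilon>}. f s = f t) \<and>
         (\<forall>s\<in>{1-\<epsilon><..1}. \<forall>t\<in>{1-\<epsilon><..1}. f s = f t)})" (is "_ \<in> gen_funs (gen_curves _ ?G)")
    using assms(1) by (simp add: flat_I_def gen_space_def)
  show "c s \<in> {0..1}" if "s \<in> J" for s using assms(3) that by (auto simp: flat_curve_on_def)
  show "C_inf_on J (\<lambda>s. f (c s))" if f: "f \<in> ?G" for f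
  proof (rule C_inf_on_local)
    fix s assume s: "s \<in> J"
    have cJ: "c s \<in> {0..1}" if "s \<in> J" for s using assms(3) that by (auto simp: flat_curve_on_def)
    have cont: "(c \<longlongrightarrow> c s) (nhds s)"
      using assms(3) s by (auto simp: flat_curve_on_def isCont_def tendsto_nhds_iff)
    have fI: "f \<in> gen_funs (gen_curves {0..1} {f. C_inf f})"
      using that by (simp add: I_space_def subspace_def gen_space_def real_space_def)
    obtain \<epsilon> where \<epsilon>: "0 < \<epsilon>" "\<epsilon> < 1/4" "\<forall>s\<in>{0..<\<epsilon>}. \<forall>t\<in>{0..<\<epsilon>}. f s = f t"
       "\<forall>s\<in>{1-\<epsilon><..1}. \<forall>t\<in>{1-\<epsilon><..1}. f s = f t"
      using f by blast
    consider "0 < c s" "c s < 1" | "c s = 0" | "c s = 1"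
      using cJ[OF s] by fastforce
    then show "\<exists>K. open K \<and> s \<in> K \<and> C_inf_on K (\<lambda>s. f (c s))"
    proof cases
      case 1
      then obtain K where K: "open K" "s \<in> K" "C_inf_on K c"
        using assms(3) s by (auto simp: flat_curve_on_def)
      \<comment> \<open>The generator \<open>f\<close> is controlled only through curves in the unit
        interval, so locality for that interval takes the place of the chain rule.\<close>
      have "C_inf_on (K \<inter> J) (\<lambda>s. f (c s))"
      proof (rule gen_funs_local[where g = f and c = c, OF fI])
        show "C_inf_on (K \<inter> J) (\<lambda>s. g (c s))" if "g \<in> {f. C_inf f}" for g
          using that K assms(2) C_inf_on_compose[of g "K \<inter> J" c] C_inf_on_subset[of K c "K \<inter> J"]
          by auto
      qed (use K assms(2) cJ in auto)
      then show ?thesis using K s assms(2) by (intro exI[of _ "K \<inter> J"]) auto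
    next
      case 2
      then have "\<forall>\<^sub>F x in nhds s. c x < \<epsilon>"
        using order_tendstoD(2)[OF cont] \<epsilon>(1) by auto
      then obtain K where K: "open K" "s \<in> K" "\<And>x. x \<in> K \<Longrightarrow> c x < \<epsilon>"
        by (auto simp: eventually_nhds)
      have "C_inf_on (K \<inter> J) (\<lambda>x. f (c x)) \<longleftrightarrow> C_inf_on (K \<inter> J) (\<lambda>x. f 0)"
      proof (rule C_inf_on_cong)
        show "f (c x) = f 0" if "x \<in> K \<inter> J" for x
          by (rule \<epsilon>(3)[rule_format]) (use that K(3)[of x] cJ[of x] \<epsilon>(1) in auto)
      qed (use K(1) assms(2) in auto)
      then show ?thesis
        using K s assms(2) by (intro exI[of _ "K \<inter> J"]) (auto intro: C_inf_on_const)
    next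
      case 3
      then have "\<forall>\<^sub>F x in nhds s. 1 - \<epsilon> < c x"
        using order_tendstoD(1)[OF cont] \<epsilon>(1) by auto
      then obtain K where K: "open K" "s \<in> K" "\<And>x. x \<in> K \<Longrightarrow> 1 - \<epsilon> < c x"
        by (auto simp: eventually_nhds)
      have "C_inf_on (K \<inter> J) (\<lambda>x. f (c x)) \<longleftrightarrow> C_inf_on (K \<inter> J) (\<lambda>x. f 1)"
      proof (rule C_inf_on_cong)
        show "f (c x) = f 1" if "x \<in> K \<inter> J" for x
          by (rule \<epsilon>(4)[rule_format]) (use that K(3)[of x] cJ[of x] \<epsilon>(1) in auto)
      qed (use K(1) assms(2) in auto)
      then show ?thesis
        using K s assms(2) by (intro exI[of _ "K \<inter> J"]) (auto intro: C_inf_on_const)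
    qed
  qed
qed (fact assms(2))

text \<open>Smooth steps separate values and so force continuity; a cut-off identity then recovers
  the curve itself near an interior value.\<close>

lemma flat_curve_onI:
  assumes "\<And>s. c s \<in> {0..1}" and test: "\<And>b. flat_test b \<Longrightarrow> C_inf (\<lambda>s. b (c s))"
  shows "flat_curve_on UNIV c"
proof -
  have test_cont: "((\<lambda>s. b (c s)) \<longlongrightarrow> b (c s)) (at s)" if "flat_test b" for b s
    using test[OF that] C_inf_on_continuous[of UNIV _ s] by (auto simp: C_inf_def isCont_def)
  have cont: "isCont c s" for s
    unfolding isCont_def
  proof (rule order_tendstoI)
    fix y assume y: "c s < y"
    show "\<forall>\<^sub>F x in at s. c x < y"
    proof (cases "y \<le> 1")
      case True
      \<comment> \<open>The step from \<open>p\<close> to \<open>q\<close> is 0 at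
        \<open>c s\<close>, and wherever it is below 1 the curve is below \<open>q\<close>, hence
        below \<open>y\<close>.\<close>
      obtain q where q: "c s < q" "q < y" using y dense by blast
      obtain p where p: "c s < p" "p < q" using q dense by blast
      have "flat_test (smooth_step p q)"
        using p q True assms(1)[of s] by (intro flat_test_smooth_step) auto
      then have "\<forall>\<^sub>F x in at s. smooth_step p q (c x) < 1"
        using test_cont[of "smooth_step p q" s] p by (intro order_tendstoD(2)) (auto simp: smooth_step_eq_0)
      then show ?thesis
      proof eventually_elim
        case (elim x)
        then show ?case using p q smooth_step_eq_1[of p q "c x"] by (cases "q \<le> c x") auto
      qed
    next
      case False
      then have "c x < y" for x using assms(1)[of x] by auto
      then show ?thesis by simp
    qed
  next
    fix y assume y: "y < c s"
    show "\<forall>\<^sub>F x in at s. y < c x"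
    proof (cases "0 \<le> y")
      case True
      obtain q where q: "y < q" "q < c s" using y dense by blast
      obtain p where p: "y < p" "p < q" using q dense by blast
      have "flat_test (smooth_step p q)"
        using p q True assms(1)[of s] by (intro flat_test_smooth_step) auto
      then have "\<forall>\<^sub>F x in at s. 0 < smooth_step p q (c x)"
        using test_cont[of "smooth_step p q" s] p q
        by (intro order_tendstoD(1)) (auto simp: smooth_step_eq_1)
      then show ?thesis
      proof eventually_elim
        case (elim x)
        then show ?case using p q smooth_step_eq_0[of "c x" p q] by (cases "c x \<le> p") auto
      qed
    next
      case False
      then have "y < c x" for x using assms(1)[of x] by auto
      then show ?thesis by simp
    qed
  qed
  have "\<exists>K. open K \<and> s \<in> K \<and> C_inf_on K c" if s: "0 < c s" "c s < 1" for s
  proof -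
    define a where "a = c s"
    let ?l = "smooth_step (a/4) (a/2)" and ?u = "smooth_step ((1+a)/2) ((3+a)/4)"
    \<comment> \<open>The two steps cut the identity off near 0 and near 1; between a/2 and (1+a)/2,
      hence around \<open>a\<close>, \<open>b\<close> is still the identity.\<close>
    define b where "b t = t * (?l t * (1 - ?u t))" for t
    have a: "0 < a" "a < 1" using s by (auto simp: a_def)
    have "C_inf ?l" "C_inf ?u" using a by (auto intro!: C_inf_smooth_step)
    then have "C_inf b"
      unfolding C_inf_def b_def
      by (intro C_inf_on_mult C_inf_on_diff C_inf_on_ident C_inf_on_const open_UNIV)
    moreover have "\<forall>t\<le>a/4. b t = b 0"
      using a by (auto simp: b_def smooth_step_eq_0)
    moreover have "\<forall>t\<ge>(3+a)/4. b t = b 1"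
      using a by (auto simp: b_def smooth_step_eq_1)
    moreover have "0 < a/4" "(3+a)/4 < 1" using a by auto
    ultimately have "flat_test b" using flat_testI[of b "a/4" "(3+a)/4"] by blast
    then have "C_inf (\<lambda>x. b (c x))" by (rule test)
    define K where "K = c -` {a/2<..<(1+a)/2}"
    have "open K"
      unfolding K_def using cont
      by (intro continuous_open_vimage) (auto simp: continuous_at_imp_continuous_on)
    have "b (c x) = c x" if "x \<in> K" for x
      using that a by (auto simp: K_def b_def smooth_step_eq_0 smooth_step_eq_1)
    then have "C_inf_on K c"
      using C_inf_on_cong[OF \<open>open K\<close>, of "\<lambda>x. b (c x)" c] \<open>C_inf (\<lambda>x. b (c x))\<close>
      by (auto intro: C_inf_imp_C_inf_on)
    then show ?thesis
      using \<open>open K\<close> a by (intro exI[of _ K]) (auto simp: K_def a_def)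
  qed
  then show ?thesis using assms(1) cont by (auto simp: flat_curve_on_def)
qed

section \<open>Functions along curves, and products with the flattened interval\<close>

lemma frolicher_funI:
  assumes "frolicher X" "\<And>c. c \<in> fcurves X \<Longrightarrow> C_inf (\<lambda>s. g (c s))"
  shows "g \<in> ffuns X"
proof -
  have "ffuns X = gen_funs (fcurves X)" using assms(1) unfolding frolicher_def by blast
  then show ?thesis using assms(2) by (simp add: gen_funs_def comp_def)
qed

lemma frolicher_fun_along_curve:
  assumes "frolicher X" "g \<in> ffuns X" "c \<in> fcurves X"
  shows "C_inf (\<lambda>s. g (c s))"
proof -
  have "ffuns X = gen_funs (fcurves X)" using assms(1) unfolding frolicher_def by blast
  then show ?thesis using assms(2,3) by (simp add: gen_funs_def comp_def)
qed

lemma frolicher_curve_in_carrier: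
  assumes "frolicher X" "c \<in> fcurves X"
  shows "c s \<in> fcarrier X"
proof -
  have "fcurves X = gen_curves (fcarrier X) (ffuns X)"
    using assms(1) unfolding frolicher_def by blast
  then show ?thesis using assms(2) by (simp add: gen_curves_def)
qed

lemma ffuns_prod_space: "ffuns (prod_space A B) = gen_funs (fcurves (prod_space A B))"
  by (simp add: prod_space_def gen_space_def)

lemma prod_flat_I_funs_local:
  assumes "g \<in> ffuns (prod_space flat_I X)" "open J" "flat_curve_on J t"
    and "\<And>s. s \<in> J \<Longrightarrow> x s \<in> fcarrier X"
    and "\<And>\<phi>. \<phi> \<in> ffuns X \<Longrightarrow> C_inf_on J (\<lambda>s. \<phi> (x s))"
  shows "C_inf_on J (\<lambda>s. g (t s, x s))"
proof (rule gen_funs_local[where g = g and c = "\<lambda>s. (t s, x s)"])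
  show "g \<in> gen_funs (gen_curves ({0..1} \<times> fcarrier X)
      ({f \<circ> fst | f. f \<in> ffuns flat_I} \<union> {g \<circ> snd | g. g \<in> ffuns X}))"
    using assms(1) by (simp add: prod_space_def gen_space_def flat_I_def)
qed (use assms flat_I_funs_local[OF _ assms(2,3)] in \<open>auto simp: flat_curve_on_def\<close>)

lemma prod_flat_I_curveD:
  assumes "c \<in> fcurves (prod_space flat_I X)"
  shows "fst (c s) \<in> {0..1}" "snd (c s) \<in> fcarrier X"
    and "b \<in> ffuns flat_I \<Longrightarrow> C_inf (\<lambda>s. b (fst (c s)))"
    and "\<phi> \<in> ffuns X \<Longrightarrow> C_inf (\<lambda>s. \<phi> (snd (c s)))"
proof -
  have "c s \<in> {0..1} \<times> fcarrier X"
    using assms by (auto simp: prod_space_def gen_space_def gen_curves_def flat_I_def)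
  then show "fst (c s) \<in> {0..1}" "snd (c s) \<in> fcarrier X" by auto
  show "C_inf (\<lambda>s. b (fst (c s)))" if "b \<in> ffuns flat_I"
    using assms that by (force simp: prod_space_def gen_space_def gen_curves_def comp_def)
  show "C_inf (\<lambda>s. \<phi> (snd (c s)))" if "\<phi> \<in> ffuns X"
    using assms that by (force simp: prod_space_def gen_space_def gen_curves_def comp_def)
qed

section \<open>Coordinates on the mapping cylinder\<close>

locale flat_mapping_cylinder =
  fixes X :: "'a frol" and Y :: "'b frol" and f :: "'a \<Rightarrow> 'b"
  assumes frolicher_X: "frolicher X" and frolicher_Y: "frolicher Y"
begin

abbreviation M :: "((real \<times> 'a) + 'b) set frol" where "M \<equiv> mapping_cyl X Y f"

abbreviation cls :: "(real \<times> 'a) + 'b \<Rightarrow> ((real \<times> 'a) + 'b) set" where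
  "cls p \<equiv> cyl_rel X Y f `` {p}"

definition pts :: "((real \<times> 'a) + 'b) set" where
  "pts = Inl ` ({0..1} \<times> fcarrier X) \<union> Inr ` fcarrier Y"

definition glue :: "(((real \<times> 'a) + 'b) \<times> ((real \<times> 'a) + 'b)) set" where
  "glue = {(Inl (1, x), Inr (f x)) | x. x \<in> fcarrier X}"

lemma carrier_sum: "fcarrier (sum_space (prod_space flat_I X) Y) = pts"
  by (simp add: sum_space_def prod_space_def gen_space_def flat_I_def pts_def)

lemma cyl_rel_eq: "cyl_rel X Y f = (glue \<union> glue\<inverse>)\<^sup>* \<inter> pts \<times> pts"
  by (simp add: cyl_rel_def carrier_sum glue_def Let_def)

lemma equiv_cyl_rel: "equiv pts (cyl_rel X Y f)"
proof (rule equivI)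
  show "refl_on pts (cyl_rel X Y f)" by (auto simp: cyl_rel_eq refl_on_def)
  have "sym ((glue \<union> glue\<inverse>)\<^sup>*)" by (simp add: sym_Un_converse sym_rtrancl)
  then show "sym (cyl_rel X Y f)" by (auto simp: cyl_rel_eq sym_def)
  show "trans (cyl_rel X Y f)" by (auto simp: cyl_rel_eq trans_def)
qed (auto simp: cyl_rel_eq)

definition height :: "(real \<times> 'a) + 'b \<Rightarrow> real" where
  "height = case_sum fst (\<lambda>_. 1)"

lemma height_simps [simp]: "height (Inl (t, x)) = t" "height (Inr y) = 1"
  by (simp_all add: height_def)

text \<open>Both ends of every gluing pair have height 1, so the height descends to the
  quotient.\<close>

lemma cyl_rel_height:
  assumes "(p, q) \<in> cyl_rel X Y f"
  shows "height p = height q"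
proof -
  from assms have "(p, q) \<in> (glue \<union> glue\<inverse>)\<^sup>*" by (simp add: cyl_rel_eq)
  then show ?thesis by (induction rule: rtrancl_induct) (auto simp: glue_def)
qed

text \<open>No gluing step, in either direction, starts at a cylinder point with
  \<open>t \<noteq> 1\<close>.\<close>

lemma cyl_rel_below_top:
  assumes "(Inl (t, x), q) \<in> cyl_rel X Y f" "t \<noteq> 1"
  shows "q = Inl (t, x)"
proof -
  from assms have "(Inl (t, x), q) \<in> (glue \<union> glue\<inverse>)\<^sup>*" by (simp add: cyl_rel_eq)
  then show ?thesis by (induction rule: rtrancl_induct) (use assms(2) in \<open>auto simp: glue_def\<close>)
qed

text \<open>An arbitrary representative. The choice does not affect \<open>tau\<close>, since the
  height is constant on classes.\<close>

definition rep :: "((real \<times> 'a) + 'b) set \<Rightarrow> (real \<times> 'a) + 'b" where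
  "rep z = (SOME p. p \<in> z)"

definition tau :: "((real \<times> 'a) + 'b) set \<Rightarrow> real" where
  "tau z = height (rep z)"

text \<open>Meaningful only where \<^term>\<open>tau z < 1\<close>: there the class of a point is a singleton.\<close>
definition xi :: "((real \<times> 'a) + 'b) set \<Rightarrow> 'a" where
  "xi z = snd (projl (rep z))"

lemma carrier_M: "fcarrier M = pts // cyl_rel X Y f"
  by (simp add: mapping_cyl_def quot_space_def gen_space_def flip: carrier_sum)

lemma cls_in_M: "p \<in> pts \<Longrightarrow> cls p \<in> fcarrier M"
  by (simp add: carrier_M quotientI)

lemma rep_cls: "p \<in> pts \<Longrightarrow> (p, rep (cls p)) \<in> cyl_rel X Y f"
  using someI[of "\<lambda>q. q \<in> cls p" p] equiv_class_self[OF equiv_cyl_rel]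
  by (simp add: rep_def)

lemma rep_in_pts: "z \<in> fcarrier M \<Longrightarrow> rep z \<in> pts"
  unfolding carrier_M by (elim quotientE) (use rep_cls cyl_rel_eq in auto)

lemma cls_rep: "z \<in> fcarrier M \<Longrightarrow> cls (rep z) = z"
  unfolding carrier_M
  by (elim quotientE) (use rep_cls equiv_class_eq[OF equiv_cyl_rel] in blast)

lemma tau_cls: "p \<in> pts \<Longrightarrow> tau (cls p) = height p"
  using cyl_rel_height[OF rep_cls] by (simp add: tau_def)

lemma xi_cls: "Inl (t, x) \<in> pts \<Longrightarrow> t < 1 \<Longrightarrow> xi (cls (Inl (t, x))) = x"
  using cyl_rel_below_top[OF rep_cls, of t x] by (simp add: xi_def)

lemma tau_bounds: "z \<in> fcarrier M \<Longrightarrow> tau z \<in> {0..1}"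
  using rep_in_pts[of z] by (auto simp: tau_def pts_def)

lemma cls_coordinates:
  assumes "z \<in> fcarrier M" "tau z < 1"
  shows "xi z \<in> fcarrier X" "cls (Inl (tau z, xi z)) = z"
proof -
  from assms obtain t x where "rep z = Inl (t, x)" "x \<in> fcarrier X"
    using rep_in_pts[OF assms(1)] by (auto simp: tau_def pts_def)
  then show "xi z \<in> fcarrier X" "cls (Inl (tau z, xi z)) = z"
    using cls_rep[OF assms(1)] by (auto simp: tau_def xi_def)
qed

section \<open>Structure curves and structure functions of the cylinder\<close>

lemma curve_in_M: "z \<in> fcurves M \<Longrightarrow> z s \<in> fcarrier M"
  by (simp add: mapping_cyl_def quot_space_def gen_space_def gen_curves_def)

lemma funs_M: "ffuns M = gen_funs (fcurves M)"
  by (simp add: mapping_cyl_def quot_space_def gen_space_def)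

text \<open>A function whose pullbacks to both summands are structure functions is one of the
  generators of the quotient structure, hence smooth along all its curves.\<close>

lemma fun_along_M_curve:
  assumes "z \<in> fcurves M"
    and "\<And>c. c \<in> fcurves (prod_space flat_I X) \<Longrightarrow> C_inf (\<lambda>s. g (cls (Inl (c s))))"
    and "\<And>c. c \<in> fcurves Y \<Longrightarrow> C_inf (\<lambda>s. g (cls (Inr (c s))))"
  shows "C_inf (\<lambda>s. g (z s))"
proof -
  have "(\<lambda>p. g (cls p)) \<in> ffuns (sum_space (prod_space flat_I X) Y)"
    unfolding sum_space_def gen_space_def frol.simps
  proof (intro generator_in_gen_funs CollectI conjI)
    show "(\<lambda>p. g (cls p)) \<circ> Inl \<in> ffuns (prod_space flat_I X)"
      using assms(2) by (simp add: ffuns_prod_space gen_funs_def comp_def)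
    show "(\<lambda>p. g (cls p)) \<circ> Inr \<in> ffuns Y"
      using assms(3) by (intro frolicher_funI[OF frolicher_Y]) simp
  qed
  then show ?thesis
    using assms(1)
    by (simp add: mapping_cyl_def quot_space_def gen_space_def gen_curves_def comp_def)
qed

text \<open>The map from the product to the cylinder sends structure curves to structure
  curves.\<close>

lemma fun_M_on_prod:
  assumes "h \<in> ffuns M"
  shows "(\<lambda>p. h (cls (Inl p))) \<in> ffuns (prod_space flat_I X)"
proof -
  have "C_inf (\<lambda>s. h (cls (Inl (c s))))" if c: "c \<in> fcurves (prod_space flat_I X)" for c
  proof -
    have in_pts: "Inl (c s) \<in> pts" for s
      using prod_flat_I_curveD(1,2)[OF c, of s] by (auto simp: pts_def image_iff mem_Times_iff)
    have "C_inf (g \<circ> Inl \<circ> c)" if "g \<circ> Inl \<in> ffuns (prod_space flat_I X)" for g :: "_ \<Rightarrow> real"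
      using that c by (simp add: ffuns_prod_space gen_funs_def comp_assoc)
    then have "Inl \<circ> c \<in> fcurves (sum_space (prod_space flat_I X) Y)"
      using in_pts carrier_sum
      by (auto simp: sum_space_def gen_space_def gen_curves_def comp_assoc)
    then have "(\<lambda>s. cls (Inl (c s))) \<in> fcurves M"
      using cls_in_M[OF in_pts]
      by (simp add: mapping_cyl_def quot_space_def gen_space_def gen_curves_def gen_funs_def
          sum_space_def comp_def)
    then show ?thesis using assms by (simp add: funs_M gen_funs_def comp_def)
  qed
  then show ?thesis by (simp add: ffuns_prod_space gen_funs_def comp_def)
qed

text \<open>A test function of \<open>tau\<close> pulls back to the same function of the first
  coordinate on the product and to a constant on \<open>Y\<close>, so it is smooth along
  \<open>z\<close>; \<open>flat_curve_onI\<close> then applies.\<close>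

lemma flat_curve_tau:
  assumes "z \<in> fcurves M"
  shows "flat_curve_on UNIV (\<lambda>s. tau (z s))"
proof (rule flat_curve_onI)
  show "tau (z s) \<in> {0..1}" for s using tau_bounds[OF curve_in_M[OF assms]] .
  fix b assume b: "flat_test b"
  show "C_inf (\<lambda>s. b (tau (z s)))"
  proof (rule fun_along_M_curve[OF assms, where g = "\<lambda>z. b (tau z)"])
    fix c assume c: "c \<in> fcurves (prod_space flat_I X)"
    have "tau (cls (Inl (c s))) = fst (c s)" for s
      using prod_flat_I_curveD(1,2)[OF c, of s] tau_cls[of "Inl (c s)"]
      by (cases "c s") (auto simp: pts_def)
    then show "C_inf (\<lambda>s. b (tau (cls (Inl (c s)))))"
      using prod_flat_I_curveD(3)[OF c flat_test_in_flat_I[OF b]] by simp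
  next
    fix c assume c: "c \<in> fcurves Y"
    then have "c s \<in> fcarrier Y" for s
      by (rule frolicher_curve_in_carrier[OF frolicher_Y])
    then have "tau (cls (Inr (c s))) = 1" for s
      using tau_cls[of "Inr (c s)"] by (auto simp: pts_def)
    then show "C_inf (\<lambda>s. b (tau (cls (Inr (c s)))))"
      by (simp add: C_inf_def C_inf_on_const)
  qed
qed

lemma open_tau_preimage:
  assumes "z \<in> fcurves M" "open U"
  shows "open {s. tau (z s) \<in> U}"
proof -
  have "continuous_on UNIV (\<lambda>s. tau (z s))"
    using flat_curve_tau[OF assms(1)]
    by (auto simp: flat_curve_on_def intro: continuous_at_imp_continuous_on)
  then show ?thesis
    using open_vimage[OF assms(2)] by (simp add: vimage_def)
qed

text \<open>Curves of a quotient need not lift, but below the top they do: the functions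
  \<open>[t, x] \<mapsto> \<beta> t * \<phi> x\<close> with \<open>\<beta> = 0\<close> near \<open>1\<close> are well defined on the cylinder and detect the
  second coordinate.\<close>
lemma xi_smooth_below_top:
  assumes "z \<in> fcurves M" "\<phi> \<in> ffuns X"
  shows "C_inf_on {s. tau (z s) < 1} (\<lambda>s. \<phi> (xi (z s)))"
proof (rule C_inf_on_local)
  fix s assume "s \<in> {s. tau (z s) < 1}"
  then obtain p where p: "tau (z s) < p" "p < 1" using dense by blast
  \<comment> \<open>Two heights are chosen: the cut-off is 1 up to \<open>p\<close>, where \<phi> is
    to be recovered, and 0 from \<open>q\<close> on, which lies below the glued end.\<close>
  obtain q where q: "p < q" "q < 1" using p dense by blast
  have "0 < p" using p tau_bounds[OF curve_in_M[OF assms(1)], of s] by auto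
  define \<beta> where "\<beta> t = 1 - smooth_step p q t" for t
  have \<beta>: "\<beta> \<in> ffuns flat_I"
    unfolding \<beta>_def using \<open>0 < p\<close> q
    by (intro flat_test_in_flat_I flat_test_one_minus flat_test_smooth_step) auto
  have "C_inf (\<lambda>s. \<beta> (tau (z s)) * \<phi> (xi (z s)))"
  proof (rule fun_along_M_curve[OF assms(1), where g = "\<lambda>z. \<beta> (tau z) * \<phi> (xi z)"])
    fix c assume c: "c \<in> fcurves (prod_space flat_I X)"
    have "\<beta> (tau (cls (Inl (c s)))) * \<phi> (xi (cls (Inl (c s)))) = \<beta> (fst (c s)) * \<phi> (snd (c s))" for s
    proof -
      obtain t x where tx: "c s = (t, x)" by (cases "c s")
      have in_pts: "Inl (t, x) \<in> pts"
        using prod_flat_I_curveD(1,2)[OF c, of s] tx by (auto simp: pts_def)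
      then have "t \<le> 1" by (auto simp: pts_def)
      show ?thesis
      proof (cases "t < 1")
        case True
        then show ?thesis using tau_cls[OF in_pts] xi_cls[OF in_pts] tx by simp
      next
        \<comment> \<open>Here \<open>t = 1\<close> and the factor \<beta> vanishes, so the
          unspecified value of \<open>xi\<close> at the top is harmless.\<close>
        case False
        then show ?thesis using tau_cls[OF in_pts] tx \<open>t \<le> 1\<close> q by (simp add: \<beta>_def smooth_step_eq_1)
      qed
    qed
    then show "C_inf (\<lambda>s. \<beta> (tau (cls (Inl (c s)))) * \<phi> (xi (cls (Inl (c s)))))"
      using prod_flat_I_curveD(3)[OF c \<beta>] prod_flat_I_curveD(4)[OF c assms(2)]
      by (simp add: C_inf_def C_inf_on_mult)
  next
    fix c assume c: "c \<in> fcurves Y"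
    then have "c s \<in> fcarrier Y" for s
      by (rule frolicher_curve_in_carrier[OF frolicher_Y])
    then have "tau (cls (Inr (c s))) = 1" for s
      using tau_cls[of "Inr (c s)"] by (auto simp: pts_def)
    then show "C_inf (\<lambda>s. \<beta> (tau (cls (Inr (c s)))) * \<phi> (xi (cls (Inr (c s)))))"
      using q by (simp add: \<beta>_def smooth_step_eq_1 C_inf_def C_inf_on_const)
  qed
  then have "C_inf_on {s. tau (z s) \<in> {..<p}} (\<lambda>s. \<beta> (tau (z s)) * \<phi> (xi (z s)))"
    by (rule C_inf_imp_C_inf_on)
  moreover have K: "open {s. tau (z s) \<in> {..<p}}"
    by (intro open_tau_preimage assms(1)) auto
  ultimately have "C_inf_on {s. tau (z s) \<in> {..<p}} (\<lambda>s. \<phi> (xi (z s)))"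
    by (subst (asm) C_inf_on_cong[where h = "\<lambda>s. \<phi> (xi (z s))"])
       (auto simp: \<beta>_def smooth_step_eq_0)
  then show "\<exists>K. open K \<and> s \<in> K \<and> C_inf_on K (\<lambda>s. \<phi> (xi (z s)))"
    using K p by (intro exI[of _ "{s. tau (z s) \<in> {..<p}}"]) auto
qed

section \<open>The deformation\<close>

definition sig :: "real \<Rightarrow> real" where "sig = smooth_step (1/4) (3/4)"

definition lam :: "real \<Rightarrow> real" where "lam t = 1 - smooth_step (1/2) (3/4) t"

lemma sig_bounds: "0 \<le> sig t" "sig t \<le> 1"
  and lam_bounds: "0 \<le> lam t" "lam t \<le> 1"
  using smooth_step_bounds[of "1/4" "3/4" t] smooth_step_bounds[of "1/2" "3/4" t]
  by (auto simp: sig_def lam_def)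

lemma C_inf_sig: "C_inf sig" and C_inf_lam: "C_inf lam"
  unfolding sig_def lam_def
  by (simp_all add: C_inf_smooth_step)
     (simp add: C_inf_def C_inf_on_diff C_inf_on_const C_inf_smooth_step[unfolded C_inf_def])

definition level :: "real \<Rightarrow> real \<Rightarrow> real" where
  "level t r = (1 - sig t * lam r) * r"

lemma level_bounds: "0 \<le> r \<Longrightarrow> 0 \<le> level t r \<and> level t r \<le> r"
  using mult_le_one[OF sig_bounds(2) lam_bounds, of t r]
    mult_nonneg_nonneg[OF sig_bounds(1) lam_bounds(1), of t r]
  by (auto simp: level_def intro: mult_left_le_one_le)

text \<open>The case split avoids \<open>xi\<close> at the top, where it is meaningless. The
  branches fit together because the first is already the identity from height 3/4 on.\<close>

definition retr :: "real \<times> ((real \<times> 'a) + 'b) set \<Rightarrow> ((real \<times> 'a) + 'b) set" where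
  "retr = (\<lambda>(t, z). if tau z < 1 then cls (Inl (level t (tau z), xi z)) else z)"

lemma retr_high: "z \<in> fcarrier M \<Longrightarrow> 3/4 \<le> tau z \<Longrightarrow> retr (t, z) = z"
  using cls_coordinates[of z]
  by (simp add: retr_def level_def lam_def smooth_step_eq_1)

lemma level_in_pts:
  assumes "z \<in> fcarrier M" "tau z < 1"
  shows "Inl (level t (tau z), xi z) \<in> pts"
  using cls_coordinates[OF assms] tau_bounds[OF assms(1)] level_bounds[of "tau z" t] assms(2)
  by (auto simp: pts_def)

lemma retr_in_M: "z \<in> fcarrier M \<Longrightarrow> retr (t, z) \<in> fcarrier M"
  using cls_in_M[OF level_in_pts] by (auto simp: retr_def)

text \<open>Where \<^term>\<open>tau\<close> vanishes the time parameter may be arbitrary: there the first coordinate of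
  the deformed curve only has to be continuous, and it is squeezed between \<open>0\<close> and \<^term>\<open>tau\<close>.\<close>
lemma flat_curve_level:
  assumes z: "z \<in> fcurves M"
    and t: "\<And>s. 0 < tau (z s) \<Longrightarrow> \<exists>K. open K \<and> s \<in> K \<and> C_inf_on K (\<lambda>s. sig (t s))"
  shows "flat_curve_on {s. tau (z s) < 1} (\<lambda>s. level (t s) (tau (z s)))"
proof -
  have tau01: "0 \<le> tau (z s)" "tau (z s) \<le> 1" for s
    using tau_bounds[OF curve_in_M[OF z], of s] by auto
  have smooth: "\<exists>K. open K \<and> s \<in> K \<and> C_inf_on K (\<lambda>s. level (t s) (tau (z s)))"
    if s: "0 < tau (z s)" "tau (z s) < 1" for s
  proof -
    obtain K1 where K1: "open K1" "s \<in> K1" "C_inf_on K1 (\<lambda>s. sig (t s))" using t s by blast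
    obtain K2 where K2: "open K2" "s \<in> K2" "C_inf_on K2 (\<lambda>s. tau (z s))"
      using flat_curve_tau[OF z] s by (auto simp: flat_curve_on_def)
    have "C_inf_on (K1 \<inter> K2) (\<lambda>s. sig (t s))" "C_inf_on (K1 \<inter> K2) (\<lambda>s. tau (z s))"
      using K1 K2 C_inf_on_subset by blast+
    then have "C_inf_on (K1 \<inter> K2) (\<lambda>s. level (t s) (tau (z s)))"
      unfolding level_def using K1(1) K2(1)
      by (intro C_inf_on_mult C_inf_on_diff C_inf_on_const C_inf_on_compose[OF C_inf_lam] open_Int)
    then show ?thesis using K1 K2 by (intro exI[of _ "K1 \<inter> K2"]) auto
  qed
  have "isCont (\<lambda>s. level (t s) (tau (z s))) s" if "tau (z s) < 1" for s
  proof (cases "tau (z s) = 0")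
    case True
    have "((\<lambda>s. tau (z s)) \<longlongrightarrow> 0) (at s)"
      using flat_curve_tau[OF z] True by (auto simp: flat_curve_on_def isCont_def dest!: spec[of _ s])
    then have "((\<lambda>s. level (t s) (tau (z s))) \<longlongrightarrow> 0) (at s)"
      by (rule tendsto_sandwich[OF _ _ tendsto_const, rotated 2]) (use level_bounds tau01 in auto)
    then show ?thesis using True by (simp add: isCont_def level_def)
  next
    case False
    then show ?thesis using smooth[of s] that tau01(1)[of s] C_inf_on_continuous by fastforce
  qed
  \<comment> \<open>\<open>flat_curve_on\<close> asks for smoothness where the new level is
    positive; this transfers the condition to \<open>tau\<close>, as \<open>smooth\<close>
    requires.\<close>
  moreover have "0 < tau (z s)" if "0 < level (t s) (tau (z s))" for s
    using that tau01(1)[of s] by (cases "tau (z s) = 0") (auto simp: level_def)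
  ultimately show ?thesis
    unfolding flat_curve_on_def
    using smooth level_bounds[OF tau01(1)] tau01 by (fastforce intro: order_trans)
qed

text \<open>The common core of the smoothness of \<open>retr\<close> and of its FCIP, which differ
  only in how the hypothesis on \<open>t\<close> is met. The regions \<open>tau < 1\<close> and
  \<open>tau > 3/4\<close> cover the curve; coordinates are used on the first, the identity on the
  second.\<close>

lemma retr_smooth_along:
  assumes h: "h \<in> ffuns M" and z: "z \<in> fcurves M"
    and t: "\<And>s. 0 < tau (z s) \<Longrightarrow> \<exists>K. open K \<and> s \<in> K \<and> C_inf_on K (\<lambda>s. sig (t s))"
  shows "C_inf (\<lambda>s. h (retr (t s, z s)))"
  unfolding C_inf_def
proof (rule C_inf_on_local)
  fix s
  let ?L = "{s. tau (z s) \<in> {..<1}}" and ?U = "{s. tau (z s) \<in> {3/4<..}}"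
  have opens: "open ?L" "open ?U" by (intro open_tau_preimage z; simp)+
  have "C_inf_on ?L (\<lambda>s. h (cls (Inl (level (t s) (tau (z s)), xi (z s)))))"
  proof (rule prod_flat_I_funs_local[OF fun_M_on_prod[OF h] opens(1)])
    show "flat_curve_on ?L (\<lambda>s. level (t s) (tau (z s)))"
      using flat_curve_level[OF z t] by simp
    show "xi (z s) \<in> fcarrier X" if "s \<in> ?L" for s
      using cls_coordinates(1)[OF curve_in_M[OF z]] that by simp
    show "C_inf_on ?L (\<lambda>s. \<phi> (xi (z s)))" if "\<phi> \<in> ffuns X" for \<phi>
      using xi_smooth_below_top[OF z that] by simp
  qed
  then have "C_inf_on ?L (\<lambda>s. h (retr (t s, z s)))"
    by (subst C_inf_on_cong[OF opens(1)]) (auto simp: retr_def)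
  moreover have "C_inf_on ?U (\<lambda>s. h (retr (t s, z s)))"
  proof -
    have "C_inf (\<lambda>s. h (z s))" using h z by (auto simp: funs_M gen_funs_def comp_def)
    then show ?thesis
      by (subst C_inf_on_cong[OF opens(2), where h = "\<lambda>s. h (z s)"])
         (auto simp: retr_high curve_in_M[OF z] C_inf_imp_C_inf_on)
  qed
  moreover have "s \<in> ?L \<or> s \<in> ?U" by auto
  ultimately show "\<exists>K. open K \<and> s \<in> K \<and> C_inf_on K (\<lambda>s. h (retr (t s, z s)))"
    using opens by blast
qed

text \<open>Time enters only through \<open>sig\<close>, a structure function of
  \<open>flat_I\<close>, so the hypothesis of \<open>retr_smooth_along\<close> holds at every
  parameter.\<close>

lemma retr_pullback_in_prod:
  assumes "h \<in> ffuns M"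
  shows "h \<circ> retr \<in> ffuns (prod_space flat_I M)"
proof -
  have "C_inf (\<lambda>s. h (retr (c s)))" if c: "c \<in> fcurves (prod_space flat_I M)" for c
  proof -
    \<comment> \<open>Testing against the generators of the cylinder is enough to make the second
      component one of its structure curves.\<close>
    have "C_inf (\<lambda>s. g (snd (c s)))" if "(\<lambda>p. g (cls p)) \<in> ffuns (sum_space (prod_space flat_I X) Y)"
      for g
    proof (rule prod_flat_I_curveD(4)[OF c])
      show "g \<in> ffuns M"
        using that unfolding mapping_cyl_def quot_space_def gen_space_def frol.simps
        by (intro generator_in_gen_funs) simp
    qed
    then have "(\<lambda>s. snd (c s)) \<in> fcurves M"
      using prod_flat_I_curveD(2)[OF c]
      by (auto simp: mapping_cyl_def quot_space_def gen_space_def gen_curves_def comp_def)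
    moreover have "C_inf (\<lambda>s. sig (fst (c s)))"
      by (rule prod_flat_I_curveD(3)[OF c])
         (simp add: sig_def flat_test_in_flat_I flat_test_smooth_step)
    ultimately show ?thesis
      using retr_smooth_along[OF assms, of "\<lambda>s. snd (c s)" "\<lambda>s. fst (c s)"]
      by (auto simp: C_inf_def)
  qed
  then show ?thesis by (simp add: ffuns_prod_space gen_funs_def comp_def)
qed

section \<open>The inclusion of \<open>X\<close>, the height function and the SNDR
  conditions\<close>

abbreviation base :: "'a \<Rightarrow> ((real \<times> 'a) + 'b) set" where
  "base \<equiv> cyl_pt X Y f 0"

lemma base_image: "base ` fcarrier X = {z \<in> fcarrier M. tau z = 0}"
proof (intro set_eqI iffI)
  fix z assume "z \<in> base ` fcarrier X"
  then obtain x where x: "x \<in> fcarrier X" "z = cls (Inl (0, x))" by (auto simp: cyl_pt_def)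
  then have "Inl (0, x) \<in> pts" by (auto simp: pts_def)
  then show "z \<in> {z \<in> fcarrier M. tau z = 0}" using x cls_in_M tau_cls by simp
next
  fix z assume "z \<in> {z \<in> fcarrier M. tau z = 0}"
  then have "z = base (xi z)" "xi z \<in> fcarrier X"
    using cls_coordinates[of z] by (simp_all add: cyl_pt_def)
  then show "z \<in> base ` fcarrier X" by (rule image_eqI)
qed

lemma smooth_map_base: "smooth_map X M base"
  unfolding smooth_map_def
proof (intro conjI ballI)
  show "base ` fcarrier X \<subseteq> fcarrier M" using base_image by blast
  fix h assume h: "h \<in> ffuns M"
  have "C_inf (\<lambda>s. h (cls (Inl (0, c s))))" if c: "c \<in> fcurves X" for c
    unfolding C_inf_def
  proof (rule prod_flat_I_funs_local[OF fun_M_on_prod[OF h], where t = "\<lambda>_. 0" and x = c])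
    show "flat_curve_on UNIV (\<lambda>_. 0)" by (simp add: flat_curve_on_def)
  qed (use frolicher_curve_in_carrier[OF frolicher_X c] frolicher_fun_along_curve[OF frolicher_X _ c]
      in \<open>simp_all add: C_inf_def\<close>)
  then show "h \<circ> base \<in> ffuns X"
    by (intro frolicher_funI[OF frolicher_X]) (simp add: cyl_pt_def)
qed

lemma inj_base: "inj_on base (fcarrier X)"
proof (rule inj_on_inverseI)
  fix x assume "x \<in> fcarrier X"
  then show "xi (base x) = x" using xi_cls[of 0 x] by (auto simp: cyl_pt_def pts_def)
qed

text \<open>The factor 2 makes \<open>height_fun z < 1\<close> mean \<open>tau z < 1/2\<close>,
  where \<open>lam\<close> is 1 and the deformation at time 1 reaches level 0.\<close>

definition height_fun :: "((real \<times> 'a) + 'b) set \<Rightarrow> real" where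
  "height_fun z = min 1 (2 * tau z)"

text \<open>The kink of the minimum occurs at the value 1, an end of the flattened interval, where
  continuity is enough.\<close>

lemma smooth_map_height_fun: "smooth_map M flat_I height_fun"
  unfolding smooth_map_def
proof (intro conjI ballI)
  show "height_fun ` fcarrier M \<subseteq> fcarrier flat_I"
    using tau_bounds by (auto simp: flat_I_def gen_space_def height_fun_def)
  fix g assume g: "g \<in> ffuns flat_I"
  have "C_inf (\<lambda>s. g (height_fun (z s)))" if z: "z \<in> fcurves M" for z
    unfolding C_inf_def
  proof (rule flat_I_funs_local[OF g open_UNIV, where c = "\<lambda>s. height_fun (z s)"])
    have tau01: "tau (z s) \<in> {0..1}" for s by (rule tau_bounds[OF curve_in_M[OF z]])
    have "isCont (\<lambda>s. height_fun (z s)) s" for s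
    proof -
      have "isCont (\<lambda>s. tau (z s)) s"
        using flat_curve_tau[OF z] by (simp add: flat_curve_on_def)
      then show ?thesis unfolding height_fun_def by (intro continuous_intros)
    qed
    moreover have "\<exists>K. open K \<and> s \<in> K \<and> C_inf_on K (\<lambda>s. height_fun (z s))"
      if s: "0 < height_fun (z s)" "height_fun (z s) < 1" for s
    proof -
      have "0 < tau (z s)" "tau (z s) < 1/2" using s by (auto simp: height_fun_def min_def split: if_splits)
      then obtain K where K: "open K" "s \<in> K" "C_inf_on K (\<lambda>s. tau (z s))"
        using flat_curve_tau[OF z] by (auto simp: flat_curve_on_def)
      let ?K = "K \<inter> {s. tau (z s) \<in> {..<1/2}}"
      have oK: "open ?K" by (intro open_Int K(1) open_tau_preimage[OF z] open_lessThan)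
      have "C_inf_on ?K (\<lambda>s. 2 * tau (z s))"
        by (intro C_inf_on_mult C_inf_on_const oK C_inf_on_subset[OF K(3)]) auto
      then have "C_inf_on ?K (\<lambda>s. height_fun (z s))"
        by (subst C_inf_on_cong[OF oK, where h = "\<lambda>s. 2 * tau (z s)"]) (auto simp: height_fun_def)
      then show ?thesis using oK K \<open>tau (z s) < 1/2\<close> by (intro exI[of _ ?K]) auto
    qed
    ultimately show "flat_curve_on UNIV (\<lambda>s. height_fun (z s))"
      using tau01 by (auto simp: flat_curve_on_def height_fun_def)
  qed
  then show "g \<circ> height_fun \<in> ffuns M" by (auto simp: funs_M gen_funs_def comp_def)
qed

text \<open>\<open>Lambda_set\<close> lies in the zero set of \<open>tau\<close>. Wherever
  \<open>tau\<close> is positive, an admissible time parameter is therefore smooth nearby, which is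
  all that \<open>retr_smooth_along\<close> asks.\<close>

lemma fcip_retr: "fcip_map M X base M retr"
  unfolding fcip_map_def fcip_fun_def
proof (intro ballI conjI allI impI)
  fix h assume h: "h \<in> ffuns M"
  then show "h \<circ> retr \<in> ffuns (prod_space flat_I M)" by (rule retr_pullback_in_prod)
  fix t :: "real \<Rightarrow> real" and z
  assume "(\<forall>s. t s \<in> {0..1}) \<and> z \<in> fcurves M \<and>
     (\<forall>\<epsilon>>0. \<forall>J. open J \<and> is_interval J \<and>
        J \<inter> (\<Union>s\<in>Lambda_set M X base z. {s - \<epsilon>..s + \<epsilon>}) = {} \<longrightarrow> C_inf_on J t)"
  then have z: "z \<in> fcurves M" and t: "\<And>\<epsilon> J. \<epsilon> > 0 \<Longrightarrow> open J \<Longrightarrow> is_interval J \<Longrightarrow>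
        J \<inter> (\<Union>s\<in>Lambda_set M X base z. {s - \<epsilon>..s + \<epsilon>}) = {} \<Longrightarrow> C_inf_on J t"
    by blast+
  have "\<exists>K. open K \<and> s \<in> K \<and> C_inf_on K (\<lambda>s. sig (t s))" if s: "0 < tau (z s)" for s
  proof -
    have "open {s. tau (z s) \<in> {0<..}}" by (intro open_tau_preimage[OF z] open_greaterThan)
    then obtain r where r: "r > 0" "ball s r \<subseteq> {s. tau (z s) \<in> {0<..}}"
      using s openE by blast
    have far: "r \<le> dist s s'" if "s' \<in> Lambda_set M X base z" for s'
    proof -
      have "tau (z s') = 0" using that base_image by (auto simp: Lambda_set_def)
      then have "s' \<notin> ball s r" using r(2) by auto
      then show ?thesis by simp
    qed
    \<comment> \<open>Halving \<open>r\<close> serves both radii: a point within r/2 of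
      \<open>s\<close> and of some \<open>s'\<close> in \<open>Lambda_set\<close> would put
      \<open>s'\<close> closer to \<open>s\<close> than \<open>r\<close>.\<close>
    have "C_inf_on (ball s (r/2)) t"
    proof (rule t[of "r/2"])
      show "ball s (r/2) \<inter> (\<Union>s\<in>Lambda_set M X base z. {s - r/2..s + r/2}) = {}"
      proof (rule equals0I)
        fix y assume "y \<in> ball s (r/2) \<inter> (\<Union>s\<in>Lambda_set M X base z. {s - r/2..s + r/2})"
        then obtain s' where "s' \<in> Lambda_set M X base z" "dist s y < r/2" "s' - r/2 \<le> y" "y \<le> s' + r/2"
          by auto
        then show False using far[of s'] by (auto simp: dist_real_def abs_if split: if_splits)
      qed
    qed (use r(1) in \<open>auto simp: is_interval_ball_real\<close>)
    then have "C_inf_on (ball s (r/2)) (\<lambda>s. sig (t s))"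
      by (intro C_inf_on_compose[OF C_inf_sig]) auto
    then show ?thesis using r(1) by (intro exI[of _ "ball s (r/2)"]) auto
  qed
  then show "C_inf (h \<circ> retr \<circ> (\<lambda>s. (t s, z s)))"
    using retr_smooth_along[OF h z] by (simp add: comp_def)
qed

lemma SNDR_pair_base: "SNDR_pair M X base"
  unfolding SNDR_pair_def
proof (intro conjI exI[of _ height_fun] exI[of _ retr] ballI impI)
  show "smooth_map X M base" by (rule smooth_map_base)
  show "inj_on base (fcarrier X)" by (rule inj_base)
  show "smooth_map M flat_I height_fun" by (rule smooth_map_height_fun)
  show "{z \<in> fcarrier M. height_fun z = 0} = base ` fcarrier X"
    by (auto simp: base_image height_fun_def min_def split: if_splits)
  show "smooth_map (prod_space flat_I M) M retr"
    using retr_in_M retr_pullback_in_prod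
    by (auto simp: smooth_map_def prod_space_def gen_space_def)
  show "fcip_map M X base M retr" by (rule fcip_retr)
  show "retr (0, z) = z" if "z \<in> fcarrier M" for z
    using cls_coordinates[OF that] by (simp add: retr_def level_def sig_def smooth_step_eq_0)
  show "retr (t, z) = z" if "z \<in> base ` fcarrier X" for t z
    using that cls_coordinates[of z] by (simp add: base_image retr_def level_def)
  show "retr (1, z) \<in> base ` fcarrier X" if "z \<in> fcarrier M" "height_fun z < 1" for z
    using that cls_coordinates[of z]
    by (auto simp: height_fun_def retr_def level_def sig_def lam_def smooth_step_eq_0
        smooth_step_eq_1 cyl_pt_def)
qed

end

theorem theorem5:
  fixes X :: "'a frol" and Y :: "'b frol" and f :: "'a \<Rightarrow> 'b"
  assumes "frolicher X" and "frolicher Y" and "smooth_map X Y f"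
  shows "SNDR_pair (mapping_cyl X Y f) X (\<lambda>x. cyl_pt X Y f 0 x)"
  using flat_mapping_cylinder.SNDR_pair_base[of X Y f] assms
  by (simp add: flat_mapping_cylinder_def)

end
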